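(* Let $m\geq 1$ be an integer, let $\mathbf a=(a_1,a_2,\dots,a_m)$ be a strictly increasing sequence of $m$ integers, and let $k$ be a nonnegative integer. Consider the $m\times m$ matrix $$ \mathbf m(k;\mathbf a)=\left(\frac{(q^{i-a_j};q)_{2m+k-2i}}{q^{i\,a_j}}\right)_{i,j=1}^m , $$ where $i$ is the row index and $j$ is the column index. Then $$ \det\bigl(\mathbf m(k;\mathbf a)\bigr) = q^{\frac{m(m-1)(2m+k-1)}{2}-\sum_{l=1}^m a_l(2m-l)} \left(\prod_{j=1}^m (q^{m-a_j};q)_k\right) \prod_{i=1}^{m-1}\prod_{j=i+1}^m \left(1-q^{a_i-a_j}\right)\left(1-q^{-2m-k+1+a_i+a_j}\right). $$
   Context: Here $q$ is an indeterminate (all expressions are Laurent polynomials in $q$). The $q$-Pochhammer symbol is defined for an integer $n\ge 0$ by $(a;q)_0:=1$ and $(a;q)_n:=\prod_{j=0}^{n-1}(1-a\,q^j)$ for $n>0$. An empty product equals $1$. *)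

theory Defs
  imports
    "HOL-Computational_Algebra.Formal_Laurent_Series"
    "Jordan_Normal_Form.Determinant"
begin

definition qpochhammer :: "'a::comm_ring_1 \<Rightarrow> 'a \<Rightarrow> nat \<Rightarrow> 'a" where
  "qpochhammer a q n = (\<Prod>j<n. 1 - a * q ^ j)"

text \<open>
  The indeterminate \<open>q\<close> is \<^const>\<open>fls_X\<close>, over an arbitrary coefficient field; Laurent
  polynomials are regarded as elements of the field of formal Laurent series, where negative
  powers of \<open>q\<close> are available. The integers \<open>a 1, \<dots>, a m\<close> are the values of \<open>a\<close> on \<open>{1..m}\<close>.
\<close>

abbreviation qvar :: "'a::field fls" where
  "qvar \<equiv> fls_X"

text \<open>
  Rows and columns of \<^const>\<open>mat\<close> are numbered from \<open>0\<close>, hence the shift \<open>i = r + 1\<close>,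
  \<open>j = c + 1\<close>. The subtraction \<open>2 * m + k - 2 * i\<close> on \<^typ>\<open>nat\<close> does not truncate,
  because \<open>i \<le> m\<close>.
\<close>

definition qmatrix :: "nat \<Rightarrow> nat \<Rightarrow> (nat \<Rightarrow> int) \<Rightarrow> 'a::field fls mat" where
  "qmatrix m k a = mat m m (\<lambda>(r, c).
     let i = r + 1; j = c + 1
     in qpochhammer (qvar powi (int i - a j)) qvar (2 * m + k - 2 * i)
          / qvar powi (int i * a j))"

end

theory Submission
  imports Defs
begin

text \<open>
  Fix a column and put \<open>x = q\<^bsup>-a\<^esup>\<close>, \<open>N = 2 m + k - 1\<close>. The entry in row \<open>i\<close> is
  \<open>x\<^sup>i\<close> times the product of the factors \<open>1 - q\<^sup>t x\<close> over \<open>i \<le> t \<le> N - i\<close>. This range is symmetric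
  under \<open>t \<mapsto> N - t\<close>, and pairing \<open>t\<close> with \<open>N - t\<close> gives
  \<open>(1 - q\<^sup>t x) (1 - q\<^bsup>N-t\<^esup> x) = x (y - q\<^sup>t - q\<^bsup>N-t\<^esup>)\<close>, where \<open>y = 1/x + q\<^sup>N x\<close>.
  The \<open>k\<close> central factors \<open>m \<le> t < m + k\<close> are common to all rows; pairing up the others
  (\<open>qpochhammer_symmetric_pairing\<close>) shows that the entry equals
  \<open>x\<^sup>m (q\<^sup>m x; q)\<^sub>k\<close> times a monic polynomial in \<open>y\<close> of degree \<open>m - i\<close> whose coefficients
  do not depend on the column.

  Once the column factors are taken out, what remains is a Vandermonde determinant in the
  variables \<open>y\<^sub>1, \<dots>, y\<^sub>m\<close> (\<open>det_monic_poly\<close>), that is, the product of the differences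
  \<open>y\<^sub>i - y\<^sub>j = q\<^sup>N x\<^sub>i (1 - x\<^sub>j/x\<^sub>i) (1 - 1/(q\<^sup>N x\<^sub>i x\<^sub>j))\<close> over \<open>i < j\<close>. Collecting the powers of
  \<open>q\<close> gives the stated formula.
\<close>

section \<open>Vandermonde determinants in a basis of monic polynomials\<close>

lemma degree_prod_linear: "degree (\<Prod>t\<in>A. [:- b t, 1::'a::idom:]) = card A"
  by (cases "finite A") (simp_all add: degree_prod_sum_eq)

lemma lead_coeff_prod_linear: "lead_coeff (\<Prod>t\<in>A. [:- b t, 1::'a::idom:]) = 1"
  by (simp only: lead_coeff_prod) simp

text \<open>
  The coefficients of the \<open>p r\<close> form the matrix of a change of basis from the powers; it is upper
  triangular with ones on the diagonal, so it has determinant \<open>1\<close>.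
\<close>

lemma det_monic_poly_eq_det_powers:
  fixes p :: "nat \<Rightarrow> 'a::comm_ring_1 poly"
  assumes deg: "\<And>r. r < m \<Longrightarrow> degree (p r) = m - 1 - r"
    and monic: "\<And>r. r < m \<Longrightarrow> lead_coeff (p r) = 1"
  shows "det (mat m m (\<lambda>(r, c). poly (p r) (y c))) = det (mat m m (\<lambda>(r, c). y c ^ (m - 1 - r)))"
proof -
  define U where "U = mat m m (\<lambda>(r, s). coeff (p r) (m - 1 - s))"
  define V where "V = mat m m (\<lambda>(r, c). y c ^ (m - 1 - r))"
  have UV: "U \<in> carrier_mat m m" "V \<in> carrier_mat m m"
    by (auto simp: U_def V_def)
  have "mat m m (\<lambda>(r, c). poly (p r) (y c)) = U * V"
  proof (rule eq_matI)
    fix r c assume "r < dim_row (U * V)" "c < dim_col (U * V)"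
    then have rc: "r < m" "c < m"
      by (auto simp: U_def V_def)
    have "poly (p r) (y c) = (\<Sum>i<m. coeff (p r) i * y c ^ i)"
      unfolding poly_altdef using rc deg[OF rc(1)]
      by (intro sum.mono_neutral_left) (auto simp: coeff_eq_0)
    also have "\<dots> = (\<Sum>s<m. coeff (p r) (m - 1 - s) * y c ^ (m - 1 - s))"
      by (rule sum.reindex_bij_witness[of _ "\<lambda>s. m - 1 - s" "\<lambda>s. m - 1 - s"]) auto
    also have "\<dots> = (U * V) $$ (r, c)"
      using rc by (auto simp: U_def V_def scalar_prod_def atLeast0LessThan)
    finally show "mat m m (\<lambda>(r, c). poly (p r) (y c)) $$ (r, c) = (U * V) $$ (r, c)"
      using rc by simp
  qed (auto simp: U_def V_def)
  moreover have "det U = 1"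
  proof -
    have "upper_triangular U"
      by (rule upper_triangularI) (use deg in \<open>auto simp: U_def intro!: coeff_eq_0\<close>)
    then have "det U = prod_list (diag_mat U)"
      using UV(1) by (rule det_upper_triangular)
    also have "\<dots> = 1"
      using deg monic by (auto simp: prod_list_diag_prod U_def intro!: prod.neutral)
    finally show ?thesis .
  qed
  ultimately show ?thesis
    using det_mult[OF UV] by (simp add: V_def)
qed

text \<open>
  The determinant does not depend on which monic polynomials of the given degrees are used. For
  the Newton polynomials \<open>\<Prod>\<^bsub>t>r\<^esub> (X - y t)\<close> at the points themselves, the matrix is lower
  triangular and the determinant can be read off the diagonal.
\<close>

lemma det_monic_poly:
  fixes p :: "nat \<Rightarrow> 'a::idom poly"
  assumes deg: "\<And>r. r < m \<Longrightarrow> degree (p r) = m - 1 - r"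
    and monic: "\<And>r. r < m \<Longrightarrow> lead_coeff (p r) = 1"
  shows "det (mat m m (\<lambda>(r, c). poly (p r) (y c))) = (\<Prod>r<m. \<Prod>t=Suc r..<m. y r - y t)"
proof -
  define w where "w r = (\<Prod>t=Suc r..<m. [:- y t, 1:])" for r
  define W where "W = mat m m (\<lambda>(r, c). poly (w r) (y c))"
  have "degree (w r) = m - 1 - r" "lead_coeff (w r) = 1" if "r < m" for r
    unfolding w_def by (simp add: degree_prod_linear) (rule lead_coeff_prod_linear)
  then have "det W = det (mat m m (\<lambda>(r, c). y c ^ (m - 1 - r)))"
    unfolding W_def by (rule det_monic_poly_eq_det_powers)
  moreover have "det W = (\<Prod>r<m. \<Prod>t=Suc r..<m. y r - y t)"
  proof -
    have "det W = prod_list (diag_mat W)"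
    proof (rule det_lower_triangular)
      show "W $$ (i, j) = 0" if "i < j" "j < m" for i j
        using that by (auto simp: W_def w_def poly_prod intro!: bexI[of _ j])
    qed (auto simp: W_def)
    then show ?thesis
      by (auto simp: prod_list_diag_prod W_def w_def poly_prod atLeast0LessThan intro!: prod.cong)
  qed
  ultimately show ?thesis
    using det_monic_poly_eq_det_powers[OF deg monic] by simp
qed

lemma det_scale_cols:
  fixes f :: "nat \<Rightarrow> 'a::comm_ring_1"
  shows "det (mat m m (\<lambda>(r, c). f c * B r c)) = (\<Prod>c<m. f c) * det (mat m m (\<lambda>(r, c). B r c))"
proof -
  define D where "D = mat m m (\<lambda>(r, c). if r = c then f c else 0)"
  have D: "D \<in> carrier_mat m m"
    by (simp add: D_def)
  have "mat m m (\<lambda>(r, c). f c * B r c) = mat m m (\<lambda>(r, c). B r c) * D"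
    by (rule eq_matI) (auto simp: D_def scalar_prod_def if_distrib sum.delta cong: if_cong)
  moreover have "upper_triangular D"
    by (auto simp: D_def)
  then have "det D = (\<Prod>c<m. f c)"
    using D by (simp add: det_upper_triangular prod_list_diag_prod) (simp add: D_def atLeast0LessThan)
  ultimately show ?thesis
    using det_mult[of "mat m m (\<lambda>(r, c). B r c)" m D] D by simp
qed

section \<open>Pairing the factors of a q-Pochhammer symbol\<close>

lemma qpochhammer_Suc: "qpochhammer a q (Suc n) = qpochhammer a q n * (1 - a * q ^ n)"
  by (simp add: qpochhammer_def)

lemma qpochhammer_Suc_left: "qpochhammer a q (Suc n) = (1 - a) * qpochhammer (q * a) q n"
  unfolding qpochhammer_def by (subst prod.lessThan_Suc_shift) (simp add: mult_ac)

text \<open>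
  Downward induction on \<open>i\<close>: passing from \<open>i + 1\<close> to \<open>i\<close> adds one factor at each end of the
  product, and these two form one pair.
\<close>

lemma qpochhammer_symmetric_pairing:
  fixes x q :: "'a::field"
  assumes "x \<noteq> 0" and "i \<le> m"
  shows "x ^ i * qpochhammer (q ^ i * x) q (2 * m + k - 2 * i) =
    x ^ m * qpochhammer (q ^ m * x) q k *
      (\<Prod>t=i..<m. inverse x + q ^ (2 * m + k - 1) * x - (q ^ t + q ^ (2 * m + k - 1 - t)))"
  using \<open>i \<le> m\<close>
proof (induction rule: inc_induct)
  case base
  show ?case by simp
next
  case (step n)
  let ?N = "2 * m + k - 1" and ?L = "2 * m + k - 2 * Suc n"
  let ?c = "inverse x + q ^ ?N * x - (q ^ n + q ^ (?N - n))"
  have len: "2 * m + k - 2 * n = Suc (Suc ?L)" and last: "n + Suc ?L = ?N - n" and N: "n + (?N - n) = ?N"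
    using step.hyps by auto
  have "qpochhammer (q ^ n * x) q (2 * m + k - 2 * n) =
      (1 - q ^ n * x) * (1 - q ^ (n + Suc ?L) * x) * qpochhammer (q ^ Suc n * x) q ?L"
    unfolding len by (subst qpochhammer_Suc, subst qpochhammer_Suc_left) (simp add: power_add mult_ac)
  also have "(1 - q ^ n * x) * (1 - q ^ (n + Suc ?L) * x) = x * ?c"
    unfolding last using assms(1) power_add[of q n "?N - n"] unfolding N
    by (simp add: field_simps)
  finally have "x ^ n * qpochhammer (q ^ n * x) q (2 * m + k - 2 * n) =
      ?c * (x ^ Suc n * qpochhammer (q ^ Suc n * x) q ?L)"
    by (simp add: mult_ac)
  then show ?case
    unfolding step.IH prod.atLeast_Suc_lessThan[OF step.hyps(2)] by (simp only: mult_ac)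
qed

section \<open>The determinant\<close>

text \<open>
  By the pairing, column \<open>c\<close> consists of values at one point of monic polynomials that depend only
  on the row, multiplied by a factor that depends only on the column.
\<close>

lemma det_qpochhammer_matrix:
  fixes x :: "nat \<Rightarrow> 'a::field"
  assumes x: "\<And>c. c < m \<Longrightarrow> x c \<noteq> 0"
  shows "det (mat m m (\<lambda>(r, c). x c ^ Suc r * qpochhammer (q ^ Suc r * x c) q (2 * m + k - 2 * Suc r))) =
    (\<Prod>c<m. x c ^ m * qpochhammer (q ^ m * x c) q k) *
    (\<Prod>r<m. \<Prod>t=Suc r..<m. (inverse (x r) + q ^ (2 * m + k - 1) * x r) -
                              (inverse (x t) + q ^ (2 * m + k - 1) * x t))"
proof -
  define y where "y c = inverse (x c) + q ^ (2 * m + k - 1) * x c" for c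
  define p where "p r = (\<Prod>t=Suc r..<m. [:- (q ^ t + q ^ (2 * m + k - 1 - t)), 1:])" for r
  define f where "f c = x c ^ m * qpochhammer (q ^ m * x c) q k" for c
  have p: "degree (p r) = m - 1 - r" "lead_coeff (p r) = 1" for r
    unfolding p_def by (simp only: degree_prod_linear card_atLeastLessThan; simp)
      (rule lead_coeff_prod_linear)
  have "mat m m (\<lambda>(r, c). x c ^ Suc r * qpochhammer (q ^ Suc r * x c) q (2 * m + k - 2 * Suc r))
      = mat m m (\<lambda>(r, c). f c * poly (p r) (y c))"
  proof (rule cong_mat, goal_cases)
    case (3 r c)
    then show ?case
      using qpochhammer_symmetric_pairing[OF x[OF 3(2)], of "Suc r" m q k]
      by (simp add: f_def p_def y_def poly_prod algebra_simps)
  qed auto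
  then show ?thesis
    using det_monic_poly[of m p y, OF p] by (simp add: det_scale_cols f_def y_def)
qed

lemma power_int_sum_nonzero:
  fixes q :: "'a::field"
  assumes "q \<noteq> 0"
  shows "q powi (\<Sum>i\<in>A. f i) = (\<Prod>i\<in>A. q powi f i)"
  using assms by (induction A rule: infinite_finite_induct) (auto simp: power_int_add)

theorem proposition3p1:
  fixes m k :: nat and a :: "nat \<Rightarrow> int"
  assumes "m \<ge> 1" and "strict_mono_on {1..m} a"
  shows "det (qmatrix m k a :: 'a::field fls mat) =
    qvar powi (int m * (int m - 1) * (2 * int m + int k - 1) div 2
                 - (\<Sum>l=1..m. a l * (2 * int m - int l)))
    * (\<Prod>j=1..m. qpochhammer (qvar powi (int m - a j)) qvar k)
    * (\<Prod>i=1..m - 1. \<Prod>j=i + 1..m.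
         (1 - qvar powi (a i - a j))
         * (1 - qvar powi (- 2 * int m - int k + 1 + a i + a j)))"
proof -
  define q :: "'a fls" where "q = qvar"
  have q: "q \<noteq> 0"
    by (simp add: q_def)
  define x where "x j = q powi (- a j)" for j
  define N where "N = 2 * m + k - 1"
  have N: "int N = 2 * int m + int k - 1"
    using assms(1) by (simp add: N_def)
  define P where "P j = qpochhammer (q powi (int m - a j)) q k" for j
  define y where "y j = inverse (x j) + q ^ N * x j" for j
  \<comment> \<open>Up to the power \<open>q\<^sup>N x\<^sub>i\<close>, the difference \<open>y\<^sub>i - y\<^sub>j\<close> is the \<open>(i, j)\<close> factor of the stated double
    product; see \<open>diff\<close> below.\<close>
  define F where "F i j = (1 - q powi (a i - a j)) * (1 - q powi (- 2 * int m - int k + 1 + a i + a j))" for i j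

  have x_nz: "x j \<noteq> 0" for j
    using q by (simp add: x_def)

  have qx: "q powi (int i - a j) = q ^ i * x j" for i j
    using q by (simp add: x_def power_int_diff power_int_minus field_simps)
  have diff: "y i - y j = q powi (int N - a i) * F i j" for i j
  proof -
    have exponent: "- 2 * int m - int k + 1 + a i + a j = a i + a j - int N"
      by (simp add: N)
    show ?thesis
      using q unfolding y_def x_def F_def exponent
      by (simp add: field_simps power_int_add power_int_diff power_int_minus)
  qed

  have "qmatrix m k a =
      mat m m (\<lambda>(r, c). x (Suc c) ^ Suc r * qpochhammer (q ^ Suc r * x (Suc c)) q (2 * m + k - 2 * Suc r))"
    unfolding qmatrix_def q_def[symmetric] Let_def
  proof (rule cong_mat, goal_cases)
    case (3 r c)
    have "x (Suc c) ^ Suc r = inverse (q powi (int (Suc r) * a (Suc c)))"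
      unfolding x_def mult.commute[of "int (Suc r)"] power_int_mult
      by (simp add: power_int_minus power_inverse del: power_Suc of_nat_Suc)
    then show ?case
      by (simp add: qx field_simps del: power_Suc of_nat_Suc)
  qed auto
  then have "det (qmatrix m k a) =
      (\<Prod>c<m. x (Suc c) ^ m * P (Suc c)) * (\<Prod>r<m. \<Prod>t=Suc r..<m. y (Suc r) - y (Suc t))"
    using det_qpochhammer_matrix[of m "\<lambda>c. x (Suc c)" q k] q
    by (simp add: P_def qx y_def N_def x_nz del: power_Suc of_nat_Suc)
  also have "\<dots> = (\<Prod>j=1..m. x j ^ m * P j) * (\<Prod>i=1..m. \<Prod>j=Suc i..m. y i - y j)"
    unfolding One_nat_def prod.atLeast1_atMost_eq atLeastLessThanSuc_atLeastAtMost[symmetric]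
      prod.atLeast_Suc_lessThan_Suc_shift by (simp add: comp_def atLeast0LessThan)
  also have "\<dots> = (\<Prod>i=1..m. x i ^ m * (q powi (int N - a i)) ^ (m - i))
      * (\<Prod>j=1..m. P j) * (\<Prod>i=1..m. \<Prod>j=Suc i..m. F i j)"
    by (simp add: diff prod.distrib mult_ac)
  also have "(\<Prod>i=1..m. x i ^ m * (q powi (int N - a i)) ^ (m - i)) =
      q powi (\<Sum>i=1..m. int N * (int m - int i) - a i * (2 * int m - int i))"
    unfolding power_int_sum_nonzero[OF q]
  proof (rule prod.cong)
    fix i assume "i \<in> {1..m}"
    then have "x i ^ m * (q powi (int N - a i)) ^ (m - i)
        = q powi (- a i * int m) * q powi ((int N - a i) * (int m - int i))"
      by (simp only: atLeastAtMost_iff x_def power_int_mult power_int_of_nat of_nat_diff[symmetric])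
    also have "\<dots> = q powi (int N * (int m - int i) - a i * (2 * int m - int i))"
      using q by (subst power_int_add[symmetric]) (simp_all add: algebra_simps)
    finally show "x i ^ m * (q powi (int N - a i)) ^ (m - i) =
        q powi (int N * (int m - int i) - a i * (2 * int m - int i))" .
  qed simp
  also have "(\<Sum>i=1..m. int N * (int m - int i) - a i * (2 * int m - int i)) =
      int m * (int m - 1) * (2 * int m + int k - 1) div 2 - (\<Sum>l=1..m. a l * (2 * int m - int l))"
  proof -
    have "2 * (\<Sum>i=1..m. int m - int i) = int m * (int m - 1)"
      using double_gauss_sum_from_Suc_0[of m, where ?'a=int]
      by (simp add: sum_subtractf algebra_simps)
    then have "int m * (int m - 1) * int N = 2 * (\<Sum>i=1..m. int N * (int m - int i))"
      by (simp add: sum_distrib_left[symmetric] mult_ac)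
    then show ?thesis
      by (simp add: N[symmetric] sum_subtractf)
  qed
  \<comment> \<open>The row \<open>i = m\<close> contributes an empty product.\<close>
  also have "(\<Prod>i=1..m. \<Prod>j=Suc i..m. F i j) = (\<Prod>i=1..m - 1. \<Prod>j=i + 1..m. F i j)"
    by (rule prod.mono_neutral_cong_right) auto
  finally show ?thesis
    by (simp add: P_def F_def q_def)
qed

end
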